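(* Let $\bm C\in\mathbb S^d_{++}$, $\bm a_1,\dots,\bm a_n\in\mathbb R^d$, $s\in[n]$, $\bm b_i:=\bm C^{-1/2}\bm a_i$, $\bm B:=[\bm b_1,\dots,\bm b_n]$, let $\bm I_n+\bm B^\top\bm B=\bm V^\top\bm V$ be the Cholesky factorization, and let $\bm v_i\in\mathbb R^n$ be the $i$-th column of $\bm V$. The D-optimal Data Fusion problem $$z^*:=\max_{S\subseteq[n],\,|S|=s}\log\det\Big(\bm C+\sum_{i\in S}\bm a_i\bm a_i^\top\Big)$$ is equivalent to the convex integer program $$z^*=\log\det\bm C+\max_{\bm x\in\mathcal Z_s}\ \log f\Big(\sum_{i\in[n]}x_i\bm v_i\bm v_i^\top\Big),$$ i.e. for each $S\subseteq[n]$ with $|S|=s$ and characteristic vector $\bm x\in\mathcal Z_s$ the objective values coincide, so the optimal values coincide.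
   Context: $[n]=\{1,\dots,n\}$; $\mathbb S^d_{++}$ ($\mathbb S^n_+$) is the set of symmetric positive-definite (positive-semidefinite) matrices; $\bm C^{1/2}$ is the positive-definite square root; $\mathcal Z_s:=\{\bm x\in\{0,1\}^n:\sum_i x_i=s\}$. For $\bm X\in\mathbb S^n_+$ with eigenvalues $\lambda_1\ge\cdots\ge\lambda_n\ge0$, $$f(\bm X)=\prod_{i=1}^k\lambda_i\times\Big(\frac1{s-k}\sum_{i=k+1}^n\lambda_i\Big)^{s-k},$$ where $k$ is the unique integer with $0\le k<s$ such that $\lambda_k>\frac1{s-k}\sum_{i=k+1}^n\lambda_i\ge\lambda_{k+1}$, with $\lambda_0=+\infty$ (existence and uniqueness of $k$ is a known fact). It is known (Nikolov) that $\log f$ is concave, which is why the program is called convex. *)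

theory Defs
  imports
    Complex_Main
    "Jordan_Normal_Form.Char_Poly"
    "Jordan_Normal_Form.Gauss_Jordan_Elimination"
begin

text \<open>
  Index sets are zero-based: \<open>[n]\<close> is rendered as \<open>{0..<n}\<close>, in accordance with the indexing of
  vectors and matrices. Eigenvalues keep their one-based numbering \<open>\<lambda>\<^sub>1 \<ge> \<dots> \<ge> \<lambda>\<^sub>n\<close>.
\<close>

definition pos_def :: "nat \<Rightarrow> real mat \<Rightarrow> bool" where
  "pos_def n A \<longleftrightarrow> A \<in> carrier_mat n n \<and> transpose_mat A = A \<and>
     (\<forall>v \<in> carrier_vec n. v \<noteq> 0\<^sub>v n \<longrightarrow> 0 < v \<bullet> (A *\<^sub>v v))"

definition sqrt_mat :: "real mat \<Rightarrow> real mat" where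
  "sqrt_mat A = (THE R. pos_def (dim_row A) R \<and> R * R = A)"

definition inv_sqrt_mat :: "real mat \<Rightarrow> real mat" where
  "inv_sqrt_mat A = the (mat_inverse (sqrt_mat A))"

definition cholesky_factor :: "nat \<Rightarrow> real mat \<Rightarrow> real mat \<Rightarrow> bool" where
  "cholesky_factor n A V \<longleftrightarrow> V \<in> carrier_mat n n \<and> upper_triangular V \<and>
     (\<forall>i<n. 0 < V $$ (i, i)) \<and> A = transpose_mat V * V"

definition outer :: "real vec \<Rightarrow> real mat" where
  "outer v = mat (dim_vec v) (dim_vec v) (\<lambda>(i, j). v $ i * v $ j)"

text \<open>Type \<open>mat\<close> has no zero element, so \<open>sum\<close> is not available on it.\<close>

definition finsum_mat :: "nat \<Rightarrow> ('i \<Rightarrow> real mat) \<Rightarrow> 'i set \<Rightarrow> real mat" where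
  "finsum_mat n M I = mat n n (\<lambda>(i, j). \<Sum>k\<in>I. M k $$ (i, j))"

text \<open>The eigenvalues with algebraic multiplicity, in nonincreasing order; meaningful if the
  characteristic polynomial splits over the reals, as it does for symmetric matrices.\<close>

definition sorted_eigenvalues :: "real mat \<Rightarrow> real list" where
  "sorted_eigenvalues X = (THE es. sorted_wrt (\<ge>) es \<and> char_poly X = (\<Prod>e\<leftarrow>es. [:- e, 1:]))"

definition eigval :: "real mat \<Rightarrow> nat \<Rightarrow> real" where
  "eigval X i = sorted_eigenvalues X ! (i - 1)"

definition tail_avg :: "nat \<Rightarrow> real mat \<Rightarrow> nat \<Rightarrow> real" where
  "tail_avg s X k = 1 / (real s - real k) * (\<Sum>i = k+1..dim_row X. eigval X i)"

text \<open>The disjunct \<open>k = 0\<close> encodes the convention \<open>\<lambda>\<^sub>0 = +\<infinity>\<close>.\<close>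

definition split_index :: "nat \<Rightarrow> real mat \<Rightarrow> nat" where
  "split_index s X = (THE k. k < s \<and> (k = 0 \<or> eigval X k > tail_avg s X k) \<and>
     tail_avg s X k \<ge> eigval X (k + 1))"

definition f_dopt :: "nat \<Rightarrow> real mat \<Rightarrow> real" where
  "f_dopt s X = (let k = split_index s X in
     (\<Prod>i = 1..k. eigval X i) * tail_avg s X k ^ (s - k))"

definition Zs :: "nat \<Rightarrow> nat \<Rightarrow> real vec set" where
  "Zs n s = {x \<in> carrier_vec n. (\<forall>i<n. x $ i \<in> {0, 1}) \<and> (\<Sum>i = 0..<n. x $ i) = real s}"

definition char_vec :: "nat \<Rightarrow> nat set \<Rightarrow> real vec" where
  "char_vec n S = vec n (\<lambda>i. if i \<in> S then 1 else 0)"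

definition fusion_obj :: "nat \<Rightarrow> real mat \<Rightarrow> (nat \<Rightarrow> real vec) \<Rightarrow> nat set \<Rightarrow> real" where
  "fusion_obj d C a S = ln (det (C + finsum_mat d (\<lambda>i. outer (a i)) S))"

definition weighted_gram :: "nat \<Rightarrow> (nat \<Rightarrow> real vec) \<Rightarrow> real vec \<Rightarrow> real mat" where
  "weighted_gram n v x = finsum_mat n (\<lambda>i. x $ i \<cdot>\<^sub>m outer (v i)) {0..<n}"

end

theory Submission
  imports Defs
begin

text \<open>
  Put \<open>E = diag(x)\<close> for the characteristic vector \<open>x\<close> of \<open>S\<close> and \<open>K = B\<^sup>T B\<close>. Factoring out
  \<open>C\<^bsup>1/2\<^esup>\<close> on both sides, the fusion determinant is \<open>det C * det (I + B E B\<^sup>T)\<close>, and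
  \<open>det (I + B E B\<^sup>T) = det (I + E K)\<close>. On the other side, conjugation by \<open>V\<close> makes
  \<open>X = V E V\<^sup>T\<close> similar to \<open>E V\<^sup>T V = E (I + K)\<close>, whose characteristic polynomial is
  \<open>x\<^bsup>n-s\<^esup> q(x)\<close> with \<open>q(0) = (-1)\<^sup>s det (I + E K) \<noteq> 0\<close>. So \<open>X\<close>, being positive
  semidefinite, has exactly \<open>s\<close> positive eigenvalues, with product \<open>det (I + E K)\<close>. For such \<open>X\<close>
  the defining inequalities of \<open>k\<close> force \<open>\<lambda>\<^bsub>k+1\<^esub> = \<dots> = \<lambda>\<^sub>s\<close>, hence \<open>f(X)\<close> is the product of the
  positive eigenvalues.
\<close>

subsection \<open>The spectral theorem for real symmetric matrices\<close>

lemma index_mult_mat_sum: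
  assumes "A \<in> carrier_mat m n" "B \<in> carrier_mat n p" "i < m" "j < p"
  shows "(A * B) $$ (i, j) = (\<Sum>k = 0..<n. A $$ (i, k) * B $$ (k, j))"
  using assms by (simp add: scalar_prod_def)

lemma index_mult_mat_vec_sum:
  assumes "A \<in> carrier_mat m n" "x \<in> carrier_vec n" "i < m"
  shows "(A *\<^sub>v x) $ i = (\<Sum>k = 0..<n. A $$ (i, k) * x $ k)"
  using assms by (simp add: scalar_prod_def)

lemma symmetric_index:
  assumes "transpose_mat A = A" "A \<in> carrier_mat n n" "i < n" "j < n"
  shows "A $$ (i, j) = A $$ (j, i)"
  using assms by (metis carrier_matD index_transpose_mat(1))

lemma scalar_prod_self_pos:
  fixes v :: "real vec"
  assumes "v \<in> carrier_vec n" "v \<noteq> 0\<^sub>v n"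
  shows "0 < v \<bullet> v"
proof -
  obtain i where i: "i < n" "v $ i \<noteq> 0"
    using assms by (metis carrier_vecD eq_vecI index_zero_vec)
  have "0 < (\<Sum>j = 0..<n. v $ j * v $ j)"
    by (rule sum_pos2[of _ i]) (use i in \<open>auto simp: zero_less_mult_iff\<close>)
  then show ?thesis using assms by (simp add: scalar_prod_def)
qed

text \<open>Over the complex numbers an eigenvalue exists, and symmetry makes it real. It is then a
  root of the real characteristic polynomial, which yields a real eigenvector to normalise.\<close>

lemma symmetric_real_eigenvector:
  fixes A :: "real mat"
  assumes A: "A \<in> carrier_mat n n" and sym: "transpose_mat A = A" and n: "0 < n"
  shows "\<exists>l v. v \<in> carrier_vec n \<and> v \<bullet> v = 1 \<and> A *\<^sub>v v = l \<cdot>\<^sub>v v"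
proof -
  let ?A = "map_mat complex_of_real A"
  have cA: "?A \<in> carrier_mat n n" using A by simp
  obtain as where as: "char_poly ?A = (\<Prod>a\<leftarrow>as. [:- a, 1:])" "length as = n"
    using char_poly_factorized[OF cA] by blast
  obtain a as' where "as = a # as'" using as(2) n by (cases as) auto
  then have root: "poly (char_poly ?A) a = 0" using as(1) by simp
  then obtain z where z: "z \<in> carrier_vec n" "z \<noteq> 0\<^sub>v n" "?A *\<^sub>v z = a \<cdot>\<^sub>v z"
    using eigenvalue_root_char_poly[OF cA] cA unfolding eigenvalue_def eigenvector_def by auto
  have row: "(\<Sum>j = 0..<n. complex_of_real (A $$ (i, j)) * z $ j) = a * z $ i" if "i < n" for i
  proof -
    have "(\<Sum>j = 0..<n. complex_of_real (A $$ (i, j)) * z $ j) = (?A *\<^sub>v z) $ i"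
      unfolding index_mult_mat_vec_sum[OF cA z(1) that] using that A by (intro sum.cong refl) auto
    then show ?thesis using z(1) that by (simp add: z(3))
  qed
  define N where "N = (\<Sum>i = 0..<n. (cmod (z $ i))\<^sup>2)"
  obtain i where i: "i < n" "z $ i \<noteq> 0"
    using z(1,2) by (metis carrier_vecD eq_vecI index_zero_vec)
  have N: "0 < N" unfolding N_def by (rule sum_pos2[of _ i]) (use i in auto)
  \<comment> \<open>\<open>F\<close> is the Hermitian form of \<open>A\<close> at \<open>z\<close>.
    The eigenvector equation gives \<open>F = a * N\<close>, while symmetry of \<open>A\<close>
    makes \<open>F\<close> equal to its own conjugate.\<close>
  define F where "F = (\<Sum>i = 0..<n. cnj (z $ i) * (\<Sum>j = 0..<n. of_real (A $$ (i, j)) * z $ j))"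
  have "F = (\<Sum>i = 0..<n. cnj (z $ i) * (a * z $ i))"
    unfolding F_def by (intro sum.cong refl) (simp add: row)
  also have "\<dots> = (\<Sum>i = 0..<n. a * of_real ((cmod (z $ i))\<^sup>2))"
    by (intro sum.cong refl) (simp add: complex_norm_square mult_ac del: of_real_power)
  also have "\<dots> = a * of_real N" unfolding N_def by (simp add: sum_distrib_left)
  finally have FN: "F = a * of_real N" .
  have "cnj F = (\<Sum>i = 0..<n. \<Sum>j = 0..<n. z $ i * (of_real (A $$ (i, j)) * cnj (z $ j)))"
    unfolding F_def by (simp add: cnj_sum sum_distrib_left)
  also have "\<dots> = (\<Sum>j = 0..<n. \<Sum>i = 0..<n. z $ i * (of_real (A $$ (i, j)) * cnj (z $ j)))"
    by (rule sum.swap)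
  also have "\<dots> = F"
    unfolding F_def sum_distrib_left
    by (intro sum.cong refl) (simp add: symmetric_index[OF sym A] mult_ac)
  finally have "cnj a * of_real N = a * of_real N" using FN by simp
  then have "cnj a = a" using N by simp
  then have "a = of_real (Re a)" by (simp add: complex_eq_iff)
  \<comment> \<open>Rather than splitting \<open>z\<close> into real and imaginary parts, a real
    eigenvector is drawn from the root \<open>Re a\<close> of the real polynomial.\<close>
  then have "poly (map_poly complex_of_real (char_poly A)) (of_real (Re a)) = 0"
    using root of_real_hom.char_poly_hom[OF A, where 'a=complex] by metis
  then have "poly (char_poly A) (Re a) = 0" by simp
  then obtain w where w: "w \<in> carrier_vec n" "w \<noteq> 0\<^sub>v n" "A *\<^sub>v w = Re a \<cdot>\<^sub>v w"
    using eigenvalue_root_char_poly[OF A] A unfolding eigenvalue_def eigenvector_def by auto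
  define c where "c = 1 / sqrt (w \<bullet> w)"
  have cc: "c * c * (w \<bullet> w) = 1"
    using scalar_prod_self_pos[OF w(1,2)] by (simp add: c_def)
  have "(c \<cdot>\<^sub>v w) \<bullet> (c \<cdot>\<^sub>v w) = 1" using w(1) cc by (simp add: mult.assoc)
  moreover have "A *\<^sub>v (c \<cdot>\<^sub>v w) = Re a \<cdot>\<^sub>v (c \<cdot>\<^sub>v w)"
    using A w by (simp add: mult_mat_vec smult_smult_assoc mult.commute)
  ultimately show ?thesis using w(1) by (meson smult_carrier_vec)
qed

text \<open>The reflection in the hyperplane orthogonal to \<open>v - unit_vec n 0\<close> exchanges
  these two vectors, since both have length one. Conjugation by it will move an eigenvector to the
  first axis.\<close>

lemma householder:
  fixes v :: "real vec"
  assumes v: "v \<in> carrier_vec n" and vv: "v \<bullet> v = 1" and n: "0 < n"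
  shows "\<exists>H. H \<in> carrier_mat n n \<and> transpose_mat H = H \<and> H * H = 1\<^sub>m n \<and> H *\<^sub>v unit_vec n 0 = v"
proof (cases "v = unit_vec n 0")
  case True
  then show ?thesis using n by (intro exI[of _ "1\<^sub>m n"]) auto
next
  case False
  define w where "w = v - unit_vec n 0"
  have w: "w \<in> carrier_vec n" using v by (simp add: w_def)
  have "w \<noteq> 0\<^sub>v n"
  proof
    assume "w = 0\<^sub>v n"
    moreover have "w $ i = v $ i - unit_vec n 0 $ i" if "i < n" for i
      using that v by (simp add: w_def)
    ultimately have "v $ i = unit_vec n 0 $ i" if "i < n" for i using that by fastforce
    then show False using False v by (metis carrier_vecD eq_vecI index_unit_vec(3))
  qed
  then have pos: "0 < w \<bullet> w" by (rule scalar_prod_self_pos[OF w])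
  have ww: "w \<bullet> w = 2 - 2 * v $ 0"
    using v n vv unfolding w_def
    by (simp add: minus_scalar_prod_distrib[of _ n] scalar_prod_minus_distrib[of _ n])
  \<comment> \<open>The reflection coefficient \<open>2 / (w \<bullet> w)\<close>, rewritten by
    \<open>ww\<close>.\<close>
  define c where "c = 1 / (1 - v $ 0)"
  have c: "c * (w \<bullet> w) = 2" "c * (1 - v $ 0) = 1" using pos ww by (auto simp: c_def field_simps)
  define H where "H = mat n n (\<lambda>(i, j). (if i = j then 1 else 0) - c * w $ i * w $ j)"
  have H: "H \<in> carrier_mat n n" by (simp add: H_def)
  have "transpose_mat H = H" by (rule eq_matI) (auto simp: H_def)
  moreover have "H * H = 1\<^sub>m n"
  proof (rule eq_matI)
    fix i j assume "i < dim_row (1\<^sub>m n :: real mat)" "j < dim_col (1\<^sub>m n :: real mat)"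
    then have ij: "i < n" "j < n" by auto
    have "(H * H) $$ (i, j) = (\<Sum>k = 0..<n. (if i = k then (if k = j then 1 else 0) else 0)
        - (if i = k then c * w $ k * w $ j else 0) - (if k = j then c * w $ i * w $ k else 0)
        + c * c * w $ i * w $ j * (w $ k * w $ k))"
      unfolding index_mult_mat_sum[OF H H ij] using ij
      by (intro sum.cong refl) (auto simp: H_def algebra_simps)
    also have "\<dots> = (if i = j then 1 else 0) - c * w $ i * w $ j - c * w $ i * w $ j
        + c * c * w $ i * w $ j * (w \<bullet> w)"
      using ij w by (simp add: sum.distrib sum_subtractf sum_distrib_left scalar_prod_def sum.delta sum.delta')
    \<comment> \<open>As \<open>c * (w \<bullet> w) = 2\<close>, the quadratic term cancels the two
      linear ones.\<close>
    also have "c * c * w $ i * w $ j * (w \<bullet> w) = 2 * (c * w $ i * w $ j)"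
      using c(1) by (metis mult.assoc mult.commute)
    finally show "(H * H) $$ (i, j) = 1\<^sub>m n $$ (i, j)" using ij by simp
  qed (use H in auto)
  moreover have "H *\<^sub>v unit_vec n 0 = v"
  proof (rule eq_vecI)
    fix i assume "i < dim_vec v"
    then have i: "i < n" using v by simp
    have "(H *\<^sub>v unit_vec n 0) $ i = (\<Sum>k = 0..<n. if k = 0 then H $$ (i, k) else 0)"
      unfolding index_mult_mat_vec_sum[OF H unit_vec_carrier i]
      by (intro sum.cong refl) (auto simp: unit_vec_def)
    also have "\<dots> = H $$ (i, 0)" using n by (simp add: sum.delta)
    also have "\<dots> = (if i = 0 then 1 else 0) + c * (1 - v $ 0) * w $ i"
      using i n v by (simp add: H_def w_def algebra_simps)
    also have "\<dots> = v $ i" unfolding c(2) using i n v by (simp add: w_def)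
    finally show "(H *\<^sub>v unit_vec n 0) $ i = v $ i" .
  qed (use H v in auto)
  ultimately show ?thesis using H by blast
qed

text \<open>Deflation, by induction on the dimension: after conjugation with a Householder
  reflection the first column is a multiple of the first unit vector. By symmetry so is the first
  row, and a symmetric block of size \<open>m\<close> remains.\<close>

theorem real_spectral_theorem:
  fixes A :: "real mat"
  assumes "A \<in> carrier_mat n n" and "transpose_mat A = A"
  shows "\<exists>U e. U \<in> carrier_mat n n \<and> transpose_mat U * U = 1\<^sub>m n \<and>
    A = U * mat_diag n e * transpose_mat U"
  using assms
proof (induction n arbitrary: A)
  case 0
  then show ?case by (intro exI[of _ "1\<^sub>m 0"]) (auto intro!: eq_matI)
next
  case (Suc m)
  let ?n = "Suc m"
  note A = Suc.prems(1) and sym = Suc.prems(2)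
  obtain l v where v: "v \<in> carrier_vec ?n" "v \<bullet> v = 1" "A *\<^sub>v v = l \<cdot>\<^sub>v v"
    using symmetric_real_eigenvector[OF A sym] by auto
  obtain H where H: "H \<in> carrier_mat ?n ?n" "transpose_mat H = H" "H * H = 1\<^sub>m ?n"
      "H *\<^sub>v unit_vec ?n 0 = v"
    using householder[OF v(1,2)] by auto
  define K where "K = H * A * H"
  have K: "K \<in> carrier_mat ?n ?n" using H A by (simp add: K_def)
  have Ksym: "transpose_mat K = K"
    using H A sym by (simp add: K_def transpose_mult[of _ ?n ?n _ ?n] assoc_mult_mat[of _ ?n ?n _ ?n _ ?n])
  have "H *\<^sub>v v = (H * H) *\<^sub>v unit_vec ?n 0" unfolding H(4)[symmetric] using H(1) by (intro assoc_mult_mat_vec[symmetric]) auto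
  then have Hv: "H *\<^sub>v v = unit_vec ?n 0" using H(3) by simp
  have "K *\<^sub>v unit_vec ?n 0 = H *\<^sub>v (A *\<^sub>v (H *\<^sub>v unit_vec ?n 0))"
    using H A by (simp add: K_def assoc_mult_mat_vec[of _ ?n ?n _ ?n])
  also have "\<dots> = l \<cdot>\<^sub>v unit_vec ?n 0"
    using H v Hv by (simp add: mult_mat_vec)
  finally have Ke: "K *\<^sub>v unit_vec ?n 0 = l \<cdot>\<^sub>v unit_vec ?n 0" .
  have K0: "K $$ (i, 0) = (if i = 0 then l else 0)" if "i < ?n" for i
  proof -
    have "K $$ (i, 0) = (K *\<^sub>v unit_vec ?n 0) $ i" using K that by simp
    then show ?thesis unfolding Ke using that by simp
  qed
  have K0': "K $$ (0, i) = (if i = 0 then l else 0)" if "i < ?n" for i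
    using K0[OF that] symmetric_index[OF Ksym K, of 0 i] that by simp
  define A' where "A' = mat m m (\<lambda>(i, j). K $$ (Suc i, Suc j))"
  have A': "A' \<in> carrier_mat m m" by (simp add: A'_def)
  have "transpose_mat A' = A'"
    by (rule eq_matI) (auto simp: A'_def symmetric_index[OF Ksym K])
  then obtain U e where U: "U \<in> carrier_mat m m" "transpose_mat U * U = 1\<^sub>m m"
      "A' = U * mat_diag m e * transpose_mat U"
    using Suc.IH[OF A'] by auto
  \<comment> \<open>The shift puts \<open>l\<close> at index 0, ahead of the eigenvalues of the
    block.\<close>
  define e' where "e' = case_nat l e"
  define W where "W = four_block_mat (1\<^sub>m 1) (0\<^sub>m 1 m) (0\<^sub>m m 1) U"
  have W: "W \<in> carrier_mat ?n ?n" using U by (auto simp: W_def)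
  have Wt: "transpose_mat W = four_block_mat (1\<^sub>m 1) (0\<^sub>m 1 m) (0\<^sub>m m 1) (transpose_mat U)"
    unfolding W_def using U by (subst transpose_four_block_mat[of _ 1 1 _ m _ m]) auto
  have D: "mat_diag ?n e' = four_block_mat (l \<cdot>\<^sub>m 1\<^sub>m 1) (0\<^sub>m 1 m) (0\<^sub>m m 1) (mat_diag m e)"
    by (rule eq_matI) (auto simp: mat_diag_def e'_def split: nat.split)
  have KA': "K = four_block_mat (l \<cdot>\<^sub>m 1\<^sub>m 1) (0\<^sub>m 1 m) (0\<^sub>m m 1) A'"
    by (rule eq_matI) (use K K0 K0' in \<open>auto simp: A'_def\<close>)
  have "W * mat_diag ?n e' = four_block_mat (l \<cdot>\<^sub>m 1\<^sub>m 1) (0\<^sub>m 1 m) (0\<^sub>m m 1) (U * mat_diag m e)"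
    unfolding W_def D using U
    by (subst mult_four_block_mat[of _ 1 1 _ m _ m _ _ 1 _ m])
      (auto simp: left_mult_zero_mat[OF mat_diag_dim])
  moreover have UD: "U * mat_diag m e \<in> carrier_mat m m"
    using U(1) mat_diag_dim by (rule mult_carrier_mat)
  ultimately have KW: "K = W * mat_diag ?n e' * transpose_mat W"
    unfolding Wt KA' using U(1,3)
    by (simp, subst mult_four_block_mat[of _ 1 1 _ m _ m _ _ 1 _ m])
      (auto simp: right_mult_zero_mat[OF UD] left_add_zero_mat[OF mult_carrier_mat[OF UD]])
  have WW: "transpose_mat W * W = 1\<^sub>m ?n"
    unfolding Wt unfolding W_def using U
    by (subst mult_four_block_mat[of _ 1 1 _ m _ m _ _ 1 _ m]) auto
  have HWt: "transpose_mat (H * W) = transpose_mat W * H"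
    using H W by (simp add: transpose_mult[of _ ?n ?n _ ?n])
  have "transpose_mat (H * W) * (H * W) = transpose_mat W * (H * H) * W"
    unfolding HWt using H(1) W by (simp add: assoc_mult_mat[of _ ?n ?n _ ?n _ ?n])
  then have "transpose_mat (H * W) * (H * W) = 1\<^sub>m ?n" using H W WW by simp
  moreover have "A = H * W * mat_diag ?n e' * transpose_mat (H * W)"
  proof -
    \<comment> \<open>\<open>H\<close> is its own inverse, so conjugating \<open>K\<close> by
      \<open>H\<close> recovers \<open>A\<close>.\<close>
    have "A = (H * H) * A * (H * H)" using H A by simp
    also have "\<dots> = H * K * H"
      unfolding K_def using H(1) A by (simp add: assoc_mult_mat[of _ ?n ?n _ ?n _ ?n])
    also have "\<dots> = H * W * mat_diag ?n e' * transpose_mat (H * W)"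
    proof -
      have "H * (W * D * X) * H = H * W * D * (X * H)"
        if "D \<in> carrier_mat ?n ?n" "X \<in> carrier_mat ?n ?n" for D X
        using H(1) W that by (simp add: assoc_mult_mat[of _ ?n ?n _ ?n _ ?n])
      from this[OF mat_diag_dim, of "transpose_mat W" e'] show ?thesis
        unfolding HWt KW using W by simp
    qed
    finally show ?thesis .
  qed
  ultimately show ?case using H W by (intro exI[of _ "H * W"] exI[of _ e']) auto
qed

subsection \<open>Positive definite square roots\<close>

lemma transpose_mat_diag: "transpose_mat (mat_diag n f) = mat_diag n f"
  by (rule eq_matI) (auto simp: mat_diag_def)

lemma index_mat_diag_mult_vec:
  "x \<in> carrier_vec n \<Longrightarrow> i < n \<Longrightarrow> (mat_diag n e *\<^sub>v x) $ i = e i * (x $ i :: 'a :: comm_semiring_0)"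
  by (simp add: mat_diag_def scalar_prod_def sum.delta if_distrib[of "\<lambda>t. t * _"] cong: if_cong)

text \<open>Moving \<open>U\<close> across the scalar product leaves a diagonal form.
  \<open>U\<close> may be rectangular, so the formula serves spectral decompositions as well as the
  \<open>d\<close> by \<open>n\<close> matrix \<open>B\<close>.\<close>

lemma quadratic_form_diag:
  fixes U :: "real mat"
  assumes U: "U \<in> carrier_mat m n" and x: "x \<in> carrier_vec m"
  shows "x \<bullet> (U * mat_diag n e * transpose_mat U *\<^sub>v x)
    = (\<Sum>i = 0..<n. e i * ((transpose_mat U *\<^sub>v x) $ i)\<^sup>2)"
proof -
  define y where "y = transpose_mat U *\<^sub>v x"
  have y: "y \<in> carrier_vec n" using U x by (simp add: y_def)
  have "U * mat_diag n e * transpose_mat U *\<^sub>v x = U *\<^sub>v (mat_diag n e *\<^sub>v y)"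
    unfolding y_def using U x
    by (simp add: assoc_mult_mat_vec[OF mult_carrier_mat[OF U mat_diag_dim]]
        assoc_mult_mat_vec[OF U mat_diag_dim])
  then have "x \<bullet> (U * mat_diag n e * transpose_mat U *\<^sub>v x) = y \<bullet> (mat_diag n e *\<^sub>v y)"
    using transpose_vec_mult_scalar[OF U mult_mat_vec_carrier[OF mat_diag_dim y] x]
    by (simp add: y_def)
  also have "\<dots> = (\<Sum>i = 0..<n. e i * (y $ i)\<^sup>2)"
    unfolding scalar_prod_def using y
    by (intro sum.cong)
      (auto simp: index_mat_diag_mult_vec power2_eq_square carrier_matD[OF mat_diag_dim]
        simp del: index_mult_mat_vec)
  finally show ?thesis by (simp add: y_def)
qed

lemma mult_transpose_mult_vec:
  fixes U :: "real mat"
  assumes "U \<in> carrier_mat n n" and "transpose_mat U * U = 1\<^sub>m n" and "x \<in> carrier_vec n"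
  shows "transpose_mat U *\<^sub>v (U *\<^sub>v x) = x"
  using assms by (simp flip: assoc_mult_mat_vec[of _ n n _ n])

lemma mult_unit_vec_nonzero:
  fixes U :: "real mat"
  assumes U: "U \<in> carrier_mat n n" and UU: "transpose_mat U * U = 1\<^sub>m n" and i: "i < n"
  shows "U *\<^sub>v unit_vec n i \<noteq> 0\<^sub>v n"
proof
  assume "U *\<^sub>v unit_vec n i = 0\<^sub>v n"
  then have "unit_vec n i = transpose_mat U *\<^sub>v 0\<^sub>v n"
    using mult_transpose_mult_vec[OF U UU, of "unit_vec n i"] by simp
  also have "\<dots> = 0\<^sub>v n" using U by (intro eq_vecI) auto
  finally show False using i by (metis index_unit_vec(1) index_zero_vec(1) zero_neq_one)
qed

text \<open>Column \<open>i\<close> of \<open>U\<close>, taken as test vector, isolates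
  \<open>e i\<close>. Conversely \<open>transpose_mat U\<close> is injective, so for nonzero
  \<open>x\<close> some term of the weighted sum of squares is positive.\<close>

lemma pos_def_diag_iff:
  fixes U :: "real mat"
  assumes U: "U \<in> carrier_mat n n" and UU: "transpose_mat U * U = 1\<^sub>m n"
  shows "pos_def n (U * mat_diag n e * transpose_mat U) \<longleftrightarrow> (\<forall>i<n. 0 < e i)"
proof
  assume pd: "pos_def n (U * mat_diag n e * transpose_mat U)"
  show "\<forall>i<n. 0 < e i"
  proof (intro allI impI)
    fix i assume i: "i < n"
    define x where "x = U *\<^sub>v unit_vec n i"
    have x: "x \<in> carrier_vec n" using U by (simp add: x_def)
    have Ux: "transpose_mat U *\<^sub>v x = unit_vec n i"
      unfolding x_def by (rule mult_transpose_mult_vec[OF U UU]) simp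
    have "x \<noteq> 0\<^sub>v n" unfolding x_def by (rule mult_unit_vec_nonzero[OF U UU i])
    then have "0 < (\<Sum>j = 0..<n. e j * (unit_vec n i $ j)\<^sup>2)"
      using pd x unfolding pos_def_def by (metis quadratic_form_diag[OF U x] Ux)
    also have "\<dots> = (\<Sum>j = 0..<n. if j = i then e i else 0)"
      using i by (intro sum.cong) auto
    finally show "0 < e i" using i by (simp add: sum.delta)
  qed
next
  assume e: "\<forall>i<n. 0 < e i"
  let ?A = "U * mat_diag n e * transpose_mat U"
  have UD: "U * mat_diag n e \<in> carrier_mat n n" by (rule mult_carrier_mat[OF U mat_diag_dim])
  have Ut: "transpose_mat U \<in> carrier_mat n n" using U by simp
  have "transpose_mat ?A = ?A"
    unfolding transpose_mult[OF UD Ut] transpose_mult[OF U mat_diag_dim] transpose_mat_diag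
    using assoc_mult_mat[OF U mat_diag_dim Ut, of e] by simp
  moreover have "0 < x \<bullet> (?A *\<^sub>v x)" if x: "x \<in> carrier_vec n" "x \<noteq> 0\<^sub>v n" for x
  proof -
    define y where "y = transpose_mat U *\<^sub>v x"
    have y: "y \<in> carrier_vec n" using U x by (simp add: y_def)
    have "U *\<^sub>v y = x"
      unfolding y_def using mat_mult_left_right_inverse[OF Ut U UU] U x(1)
      by (simp flip: assoc_mult_mat_vec[of _ n n _ n])
    then have "y \<noteq> 0\<^sub>v n" using x U by auto
    then obtain i where i: "i < n" "y $ i \<noteq> 0"
      using y by (metis carrier_vecD eq_vecI index_zero_vec)
    have "0 < (\<Sum>i = 0..<n. e i * (y $ i)\<^sup>2)"
      by (rule sum_pos2[of _ i]) (use i e in \<open>auto intro!: mult_nonneg_nonneg simp: less_imp_le\<close>)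
    then show ?thesis by (simp add: quadratic_form_diag[OF U x(1)] y_def)
  qed
  ultimately show "pos_def n ?A" unfolding pos_def_def using mult_carrier_mat[OF UD Ut] by blast
qed

text \<open>In a spectral decomposition the eigenvalues, positive by definiteness, are replaced by
  their square roots.\<close>

lemma pos_def_sqrt_exists:
  assumes "pos_def n A"
  shows "\<exists>R. pos_def n R \<and> R * R = A"
proof -
  obtain U e where U: "U \<in> carrier_mat n n" and UU: "transpose_mat U * U = 1\<^sub>m n"
      and A: "A = U * mat_diag n e * transpose_mat U"
    using assms real_spectral_theorem unfolding pos_def_def by metis
  have e: "0 < e i" if "i < n" for i
    using assms that unfolding A pos_def_diag_iff[OF U UU] by simp
  define D where "D = mat_diag n (\<lambda>i. sqrt (e i))"
  have D: "D \<in> carrier_mat n n" by (simp add: D_def)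
  have DD: "D * D = mat_diag n e"
    unfolding D_def mat_diag_diag by (rule eq_matI) (auto simp: mat_diag_def abs_of_pos e)
  define R where "R = U * D * transpose_mat U"
  have "pos_def n R" unfolding R_def D_def pos_def_diag_iff[OF U UU] using e by simp
  moreover have "R * R = U * D * (transpose_mat U * U) * (D * transpose_mat U)"
    unfolding R_def using U D by (simp add: assoc_mult_mat[of _ n n _ n _ n])
  then have "R * R = U * (D * D) * transpose_mat U"
    unfolding UU using U D by (simp add: assoc_mult_mat[of _ n n _ n _ n])
  ultimately show ?thesis unfolding DD A by blast
qed

text \<open>On an eigenvector \<open>x\<close> of \<open>R - R'\<close> with eigenvalue \<open>l\<close>, the equation \<open>R * R = R' * R'\<close>
  gives \<open>0 = |R x|\<^sup>2 - |R' x|\<^sup>2 = l * (x \<bullet> R x + x \<bullet> R' x)\<close>.\<close>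

lemma pos_def_sqrt_unique:
  assumes R: "pos_def n R" and R': "pos_def n R'" and eq: "R * R = R' * R'"
  shows "R = R'"
proof -
  have carr: "R \<in> carrier_mat n n" "R' \<in> carrier_mat n n"
    and sym: "transpose_mat R = R" "transpose_mat R' = R'"
    using R R' by (auto simp: pos_def_def)
  define D where "D = R - R'"
  have D: "D \<in> carrier_mat n n" using carr by (simp add: D_def minus_carrier_mat)
  have "transpose_mat D = D"
    unfolding D_def using sym carr by (simp add: transpose_minus[of _ n n])
  then obtain U e where U: "U \<in> carrier_mat n n" and UU: "transpose_mat U * U = 1\<^sub>m n"
      and DU: "D = U * mat_diag n e * transpose_mat U"
    using real_spectral_theorem[OF D] by blast
  have e0: "e i = 0" if i: "i < n" for i
  proof -
    define x where "x = U *\<^sub>v unit_vec n i"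
    have x: "x \<in> carrier_vec n" using U by (simp add: x_def)
    have Ux: "transpose_mat U *\<^sub>v x = unit_vec n i"
      unfolding x_def by (rule mult_transpose_mult_vec[OF U UU]) simp
    have "x \<noteq> 0\<^sub>v n" unfolding x_def by (rule mult_unit_vec_nonzero[OF U UU i])
    define p q where "p = R *\<^sub>v x" and "q = R' *\<^sub>v x"
    have pq: "p \<in> carrier_vec n" "q \<in> carrier_vec n" using carr x by (auto simp: p_def q_def)
    have "D *\<^sub>v x = U *\<^sub>v (mat_diag n e *\<^sub>v unit_vec n i)"
      unfolding DU using U x Ux
      by (simp add: assoc_mult_mat_vec[OF mult_carrier_mat[OF U mat_diag_dim]]
          assoc_mult_mat_vec[OF U mat_diag_dim])
    also have "mat_diag n e *\<^sub>v unit_vec n i = e i \<cdot>\<^sub>v unit_vec n i"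
      by (rule eq_vecI)
        (use i in \<open>auto simp: index_mat_diag_mult_vec carrier_matD[OF mat_diag_dim] unit_vec_def
          simp del: index_mult_mat_vec\<close>)
    also have "U *\<^sub>v (e i \<cdot>\<^sub>v unit_vec n i) = e i \<cdot>\<^sub>v x"
      using U by (simp add: x_def mult_mat_vec)
    finally have Dx: "p - q = e i \<cdot>\<^sub>v x"
      unfolding p_def q_def D_def using carr x by (simp add: minus_mult_distrib_mat_vec)
    have "p \<bullet> p = x \<bullet> (R * R *\<^sub>v x)"
      using transpose_vec_mult_scalar[OF carr(1) pq(1) x] sym carr x by (simp add: p_def)
    moreover have "q \<bullet> q = x \<bullet> (R' * R' *\<^sub>v x)"
      using transpose_vec_mult_scalar[OF carr(2) pq(2) x] sym carr x by (simp add: q_def)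
    ultimately have "p \<bullet> p = q \<bullet> q" using eq by simp
    then have "(p - q) \<bullet> (p + q) = 0"
      using pq by (simp add: minus_scalar_prod_distrib[of _ n] scalar_prod_add_distrib[of _ n]
          comm_scalar_prod[of p n q])
    then have "e i * (x \<bullet> p + x \<bullet> q) = 0"
      unfolding Dx using x pq by (simp add: scalar_prod_add_distrib[of _ n] distrib_left del: mult_eq_0_iff)
    \<comment> \<open>Positivity of both forms at \<open>x\<close> leaves only the scalar
      \<open>e i\<close> to vanish, so all eigenvalues of \<open>D\<close> are zero.\<close>
    moreover have "0 < x \<bullet> p" "0 < x \<bullet> q"
      using R R' x \<open>x \<noteq> 0\<^sub>v n\<close> by (auto simp: pos_def_def p_def q_def)
    ultimately show ?thesis by simp
  qed
  have "mat_diag n e = 0\<^sub>m n n" by (rule eq_matI) (auto simp: mat_diag_def e0)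
  then have "D = 0\<^sub>m n n" unfolding DU using U by simp
  then have "R $$ (i, j) - R' $$ (i, j) = 0" if "i < n" "j < n" for i j
    using that carr unfolding D_def by (metis carrier_matD index_minus_mat(1) index_zero_mat(1))
  then show ?thesis using carr by (intro eq_matI) auto
qed

lemma pos_def_det_nonzero:
  assumes "pos_def n A"
  shows "det A \<noteq> 0"
proof
  assume "det A = 0"
  moreover have A: "A \<in> carrier_mat n n" using assms by (simp add: pos_def_def)
  ultimately obtain v where v: "v \<in> carrier_vec n" "v \<noteq> 0\<^sub>v n" "A *\<^sub>v v = 0\<^sub>v n"
    using det_0_iff_vec_prod_zero by blast
  then have "0 < v \<bullet> 0\<^sub>v n" using assms unfolding pos_def_def by metis
  then show False using v(1) by simp
qed

lemma mat_inverse_nonsingular: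
  fixes A :: "'a :: field mat"
  assumes A: "A \<in> carrier_mat n n" and "det A \<noteq> 0"
  shows "the (mat_inverse A) \<in> carrier_mat n n" "A * the (mat_inverse A) = 1\<^sub>m n"
    "the (mat_inverse A) * A = 1\<^sub>m n"
proof -
  obtain B where "mat_inverse A = Some B"
    using mat_inverse(1)[OF A] det_non_zero_imp_unit[OF A assms(2)] by fastforce
  then show "the (mat_inverse A) \<in> carrier_mat n n" "A * the (mat_inverse A) = 1\<^sub>m n"
    "the (mat_inverse A) * A = 1\<^sub>m n"
    using mat_inverse(2)[OF A] by auto
qed

text \<open>Existence and uniqueness of the root make the definite description in
  \<open>sqrt_mat\<close> denote.\<close>

lemma sqrt_mat_pos_def:
  assumes "pos_def n A"
  shows "pos_def n (sqrt_mat A)" "sqrt_mat A * sqrt_mat A = A"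
proof -
  have n: "dim_row A = n" using assms by (auto simp: pos_def_def)
  have "\<exists>!R. pos_def n R \<and> R * R = A"
    using pos_def_sqrt_exists[OF assms] pos_def_sqrt_unique by blast
  from theI'[OF this] show "pos_def n (sqrt_mat A)" "sqrt_mat A * sqrt_mat A = A"
    unfolding sqrt_mat_def n by auto
qed

subsection \<open>Determinants and characteristic polynomials of selected rows\<close>

text \<open>The Weinstein-Aronszajn (Sylvester) identity. Both \<open>?X * ?L\<close> and
  \<open>?L * ?Y\<close> are the block matrix with rows \<open>1, - P\<close> and
  \<open>Q, 1\<close>; \<open>?L\<close> has determinant 1, and \<open>?X\<close> and
  \<open>?Y\<close> are block triangular with the two sides as determinants.\<close>

lemma det_one_add_mult_swap:
  fixes P Q :: "'a :: idom mat"
  assumes P: "P \<in> carrier_mat m n" and Q: "Q \<in> carrier_mat n m"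
  shows "det (1\<^sub>m m + P * Q) = det (1\<^sub>m n + Q * P)"
proof -
  let ?L = "four_block_mat (1\<^sub>m m) (0\<^sub>m m n) Q (1\<^sub>m n)"
  let ?X = "four_block_mat (1\<^sub>m m + P * Q) (- P) (0\<^sub>m n m) (1\<^sub>m n)"
  let ?Y = "four_block_mat (1\<^sub>m m) (- P) (0\<^sub>m n m) (1\<^sub>m n + Q * P)"
  have PQ: "P * Q \<in> carrier_mat m m" "Q * P \<in> carrier_mat n n" using P Q by auto
  have L: "?L \<in> carrier_mat (m + n) (m + n)" and X: "?X \<in> carrier_mat (m + n) (m + n)"
    and Y: "?Y \<in> carrier_mat (m + n) (m + n)" using P Q by auto
  have "?X * ?L = four_block_mat (1\<^sub>m m + P * Q + (- P) * Q) (- P) Q (1\<^sub>m n)"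
    using P Q by (subst mult_four_block_mat[of _ m m _ n _ n _ _ m _ n]) auto
  also have "1\<^sub>m m + P * Q + (- P) * Q = 1\<^sub>m m"
    using P Q PQ by (intro eq_matI) auto
  also have "four_block_mat (1\<^sub>m m) (- P) Q (1\<^sub>m n)
      = four_block_mat (1\<^sub>m m) (- P) Q (Q * (- P) + (1\<^sub>m n + Q * P))"
    using P Q PQ by (intro arg_cong[of _ _ "four_block_mat _ _ _"] eq_matI) auto
  also have "\<dots> = ?L * ?Y"
    using P Q by (subst mult_four_block_mat[of _ m m _ n _ n _ _ m _ n]) auto
  finally have eq: "det ?X * det ?L = det ?L * det ?Y"
    by (metis det_mult[OF X L] det_mult[OF L Y])
  have "det ?L = 1" using Q by (subst det_four_block_mat_upper_right_zero) auto
  moreover have "det ?X = det (1\<^sub>m m + P * Q)"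
    using P PQ by (subst det_four_block_mat_lower_left_zero) auto
  moreover have "det ?Y = det (1\<^sub>m n + Q * P)"
    using P PQ by (subst det_four_block_mat_lower_left_zero) auto
  ultimately show ?thesis using eq by simp
qed

lemma det_mat_diag: "det (mat_diag n f) = (\<Prod>i = 0..<n. f i :: 'a :: comm_ring_1)"
proof -
  have "upper_triangular (mat_diag n f)" by (auto simp: mat_diag_def)
  then have "det (mat_diag n f) = prod_list (diag_mat (mat_diag n f))"
    by (rule det_upper_triangular[OF _ mat_diag_dim])
  also have "\<dots> = (\<Prod>i = 0..<n. f i)"
    unfolding prod_list_diag_prod by (simp add: mat_diag_def)
  finally show ?thesis .
qed

text \<open>Serves both objectives: \<open>W = R * B\<close> gives the fusion sum and
  \<open>W = V\<close> the weighted Gram matrix, with the same diagonal selection matrix in the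
  middle.\<close>

lemma finsum_mat_outer_col:
  assumes W: "W \<in> carrier_mat m n"
  shows "finsum_mat m (\<lambda>i. c i \<cdot>\<^sub>m outer (col W i)) {0..<n} = W * mat_diag n c * transpose_mat W"
proof (rule eq_matI)
  fix i j assume "i < dim_row (W * mat_diag n c * transpose_mat W)"
    "j < dim_col (W * mat_diag n c * transpose_mat W)"
  then have ij: "i < m" "j < m" using W by auto
  have WD: "W * mat_diag n c \<in> carrier_mat m n" by (rule mult_carrier_mat[OF W mat_diag_dim])
  have "(W * mat_diag n c * transpose_mat W) $$ (i, j) = (\<Sum>k = 0..<n. W $$ (i, k) * c k * W $$ (j, k))"
    using W ij by (subst index_mult_mat_sum[OF WD]) (auto simp: mat_diag_mult_right[OF W])
  then show "finsum_mat m (\<lambda>i. c i \<cdot>\<^sub>m outer (col W i)) {0..<n} $$ (i, j)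
      = (W * mat_diag n c * transpose_mat W) $$ (i, j)"
    using W ij by (simp add: finsum_mat_def outer_def mult_ac)
qed (use W in \<open>auto simp: finsum_mat_def\<close>)

text \<open>Zero-one weights bring a sum over \<open>S\<close> into the form of the preceding
  lemma.\<close>

lemma finsum_mat_subset:
  fixes n :: nat
  assumes "S \<subseteq> {0..<n}" and "\<And>i. i < n \<Longrightarrow> M i \<in> carrier_mat m m"
  shows "finsum_mat m M S = finsum_mat m (\<lambda>i. of_bool (i \<in> S) \<cdot>\<^sub>m M i) {0..<n}"
proof (rule eq_matI)
  fix i j assume "i < dim_row (finsum_mat m (\<lambda>i. of_bool (i \<in> S) \<cdot>\<^sub>m M i) {0..<n})"
    "j < dim_col (finsum_mat m (\<lambda>i. of_bool (i \<in> S) \<cdot>\<^sub>m M i) {0..<n})"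
  then have ij: "i < m" "j < m" by (auto simp: finsum_mat_def)
  have "(\<Sum>k\<in>S. M k $$ (i, j)) = (\<Sum>k = 0..<n. (of_bool (k \<in> S) \<cdot>\<^sub>m M k) $$ (i, j))"
  proof (rule sum.mono_neutral_cong_left)
    show "\<forall>k \<in> {0..<n} - S. (of_bool (k \<in> S) \<cdot>\<^sub>m M k) $$ (i, j) = 0"
      using ij assms(2) by (auto simp: carrier_matD[OF assms(2)])
    fix k assume "k \<in> S"
    then have "M k \<in> carrier_mat m m" using assms by auto
    then show "M k $$ (i, j) = (of_bool (k \<in> S) \<cdot>\<^sub>m M k) $$ (i, j)"
      using ij \<open>k \<in> S\<close> by auto
  qed (use assms(1) in auto)
  then show "finsum_mat m M S $$ (i, j)
      = finsum_mat m (\<lambda>i. of_bool (i \<in> S) \<cdot>\<^sub>m M i) {0..<n} $$ (i, j)"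
    using ij by (simp add: finsum_mat_def)
qed (auto simp: finsum_mat_def)

text \<open>The rows outside \<open>S\<close> of the characteristic matrix are multiples of unit vectors; pulling out
  their factors \<open>x\<close> leaves the characteristic polynomial of the principal submatrix on \<open>S\<close>.\<close>

lemma char_poly_select_rows:
  fixes K :: "'a :: idom mat"
  assumes K: "K \<in> carrier_mat n n" and S: "S \<subseteq> {0..<n}"
  defines "E \<equiv> mat_diag n (\<lambda>i. of_bool (i \<in> S))"
  shows "\<exists>q. char_poly (E * (1\<^sub>m n + K)) = monom 1 (n - card S) * q \<and>
    poly q 0 = (- 1) ^ card S * det (1\<^sub>m n + E * K)"
proof -
  define Q where "Q = mat n n (\<lambda>(i, j). if i \<in> S then [:- (1\<^sub>m n + K) $$ (i, j), of_bool (i = j):]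
    else of_bool (i = j))"
  have Q: "Q \<in> carrier_mat n n" by (simp add: Q_def)
  have K1: "1\<^sub>m n + K \<in> carrier_mat n n" using K by simp
  have "char_poly_matrix (E * (1\<^sub>m n + K)) = mat_diag n (\<lambda>i. if i \<in> S then 1 else [:0, 1:]) * Q"
    unfolding char_poly_matrix_def E_def mat_diag_mult_left[OF K1] mat_diag_mult_left[OF Q]
    by (rule eq_matI) (use K in \<open>auto simp: Q_def one_pCons\<close>)
  then have "char_poly (E * (1\<^sub>m n + K)) = (\<Prod>i = 0..<n. if i \<in> S then 1 else [:0, 1:]) * det Q"
    unfolding char_poly_def by (simp add: det_mult[OF mat_diag_dim Q] det_mat_diag)
  also have "(\<Prod>i = 0..<n. if i \<in> S then 1 else [:0, 1:]) = (\<Prod>i \<in> {0..<n} - S. [:0, 1 :: 'a:])"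
    by (simp add: prod.If_cases Diff_eq)
  also have "\<dots> = monom 1 (n - card S)"
    using S by (simp add: monom_altdef card_Diff_subset finite_subset)
  finally have "char_poly (E * (1\<^sub>m n + K)) = monom 1 (n - card S) * det Q" .
  moreover have "poly (det Q) 0 = (- 1) ^ card S * det (1\<^sub>m n + E * K)"
  proof -
    have EK: "1\<^sub>m n + E * K \<in> carrier_mat n n"
      using mult_carrier_mat[OF mat_diag_dim K] by (simp add: E_def)
    \<comment> \<open>At 0, a row of \<open>Q\<close> in \<open>S\<close> is the negated row of
      \<open>1 + E * K\<close>, and any other row is the same unit vector in both. Each element of
      \<open>S\<close> thus contributes one sign.\<close>
    have "poly (det Q) 0 = det (mat_diag n (\<lambda>i. if i \<in> S then - 1 else 1) * (1\<^sub>m n + E * K))"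
      unfolding mat_diag_mult_left[OF EK] using K
      by (intro poly_det_cong[OF _ Q]) (auto simp: Q_def E_def mat_diag_mult_left[OF K])
    also have "\<dots> = (\<Prod>i = 0..<n. if i \<in> S then - 1 else 1) * det (1\<^sub>m n + E * K)"
      by (simp add: det_mult[OF mat_diag_dim EK] det_mat_diag)
    also have "(\<Prod>i = 0..<n. if i \<in> S then - 1 else 1) = (- 1 :: 'a) ^ card S"
      using S by (simp add: prod.If_cases Int_absorb1)
    finally show ?thesis .
  qed
  ultimately show ?thesis by blast
qed

subsection \<open>Sorted eigenvalues\<close>

text \<open>Recovers the multiset of eigenvalues from the polynomial, which is what makes the list
  in \<open>sorted_eigenvalues\<close> unique.\<close>

lemma proots_linear_factors:
  "proots (\<Prod>e\<leftarrow>es. [:- e, 1 :: 'a :: idom:]) = mset es"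
proof (induction es)
  case (Cons a es)
  have "(\<Prod>e\<leftarrow>es. [:- e, 1:]) \<noteq> 0" by (auto simp: prod_list_zero_iff)
  then have "proots ([:- a, 1:] * (\<Prod>e\<leftarrow>es. [:- e, 1:])) = {#a#} + mset es"
    by (subst proots_mult) (simp_all add: Cons.IH)
  then show ?case by simp
qed simp

text \<open>Two such lists have the same multiset of roots, and a sorted list is determined by its
  multiset. The reversals pass to the ascending order of \<open>sorted\<close>.\<close>

lemma sorted_eigenvalues_eqI:
  assumes "sorted_wrt (\<ge>) es" and "char_poly X = (\<Prod>e\<leftarrow>es. [:- e, 1:])"
  shows "sorted_eigenvalues X = es"
  unfolding sorted_eigenvalues_def
proof (rule the_equality)
  fix fs assume fs: "sorted_wrt (\<ge>) fs \<and> char_poly X = (\<Prod>e\<leftarrow>fs. [:- e, 1:])"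
  then have "mset (rev fs) = mset (rev es)"
    using assms(2) by (metis mset_rev proots_linear_factors)
  moreover have "sorted (rev fs)" "sorted (rev es)" using fs assms(1) by (auto simp: sorted_wrt_rev)
  ultimately have "rev fs = rev es" by (metis properties_for_sort)
  then show "fs = es" by simp
qed (use assms in auto)

text \<open>By the spectral theorem \<open>X\<close> is similar to a diagonal matrix, whose entries,
  sorted downwards, are the list.\<close>

lemma symmetric_char_poly_splits:
  fixes X :: "real mat"
  assumes "X \<in> carrier_mat n n" and "transpose_mat X = X"
  shows "\<exists>es. sorted_wrt (\<ge>) es \<and> char_poly X = (\<Prod>e\<leftarrow>es. [:- e, 1:])"
proof -
  obtain U e where U: "U \<in> carrier_mat n n" and UU: "transpose_mat U * U = 1\<^sub>m n"
      and X: "X = U * mat_diag n e * transpose_mat U"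
    using real_spectral_theorem[OF assms] by blast
  have "U * transpose_mat U = 1\<^sub>m n"
    using mat_mult_left_right_inverse[of "transpose_mat U" n U] U UU by simp
  then have "similar_mat_wit X (mat_diag n e) U (transpose_mat U)"
    by (rule similar_mat_witI[OF _ UU X assms(1) mat_diag_dim U]) (use U in simp)
  then have "similar_mat X (mat_diag n e)" unfolding similar_mat_def by blast
  then have "char_poly X = char_poly (mat_diag n e)" by (rule char_poly_similar)
  moreover have "upper_triangular (mat_diag n e)" by (auto simp: mat_diag_def)
  ultimately have cp: "char_poly X = (\<Prod>a\<leftarrow>diag_mat (mat_diag n e). [:- a, 1:])"
    using char_poly_upper_triangular[OF mat_diag_dim, of n e] by (simp only:)
  define es where "es = rev (sort (diag_mat (mat_diag n e)))"
  have "mset es = mset (diag_mat (mat_diag n e))" by (simp add: es_def)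
  then have "char_poly X = (\<Prod>e\<leftarrow>es. [:- e, 1:])"
    unfolding cp prod_mset_prod_list[symmetric] mset_map by simp
  moreover have "sorted_wrt (\<ge>) es" by (simp add: es_def sorted_wrt_rev)
  ultimately show ?thesis by blast
qed

text \<open>Once the list reaches 0, monotonicity and nonnegativity keep it there.\<close>

lemma sorted_nonneg_split:
  fixes es :: "real list"
  assumes "sorted_wrt (\<ge>) es" and "\<forall>e \<in> set es. 0 \<le> e"
  shows "\<exists>ps m. es = ps @ replicate m 0 \<and> (\<forall>p \<in> set ps. 0 < p)"
  using assms
proof (induction es)
  case (Cons x es)
  show ?case
  proof (cases "x = 0")
    case True
    then have "\<forall>e \<in> set (x # es). e = 0" using Cons.prems by (auto intro: antisym)
    then have "x # es = [] @ replicate (length (x # es)) 0" by (metis append_Nil replicate_eqI)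
    then show ?thesis by (metis empty_iff empty_set)
  next
    case False
    obtain ps m where ps: "es = ps @ replicate m 0" "\<forall>p \<in> set ps. 0 < p" using Cons by auto
    show ?thesis
      by (rule exI[of _ "x # ps"], rule exI[of _ m]) (use ps False Cons.prems in auto)
  qed
qed auto

lemma poly_linear_factors_0:
  "poly (\<Prod>e\<leftarrow>es. [:- e, 1 :: 'a :: comm_ring_1:]) 0 = (- 1) ^ length es * prod_list es"
  by (induction es) (auto simp: mult_ac)

text \<open>Comparing the order of the root 0 on both sides shows that there are exactly
  \<open>m\<close> zeros. Cancelling \<open>monom 1 m\<close> identifies \<open>q\<close> with the
  product of the remaining linear factors, whose constant term is known.\<close>

lemma prod_list_nonzero_eigenvalues:
  fixes q :: "real poly"
  assumes es: "sorted_wrt (\<ge>) es" "\<forall>e \<in> set es. 0 \<le> e"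
    and eq: "(\<Prod>e\<leftarrow>es. [:- e, 1:]) = monom 1 m * q" and q: "poly q 0 \<noteq> 0"
  shows "\<exists>ps. es = ps @ replicate m 0 \<and> (\<forall>p \<in> set ps. 0 < p) \<and>
    poly q 0 = (- 1) ^ length ps * prod_list ps"
proof -
  obtain ps k where ps: "es = ps @ replicate k 0" "\<forall>p \<in> set ps. 0 < p"
    using sorted_nonneg_split[OF es] by blast
  define r where "r = (\<Prod>e\<leftarrow>ps. [:- e, 1:])"
  have r0: "poly r 0 = (- 1) ^ length ps * prod_list ps" by (simp add: r_def poly_linear_factors_0)
  have r: "poly r 0 \<noteq> 0" using ps(2) by (auto simp: r0 prod_list_zero_iff)
  have eq': "monom 1 k * r = monom 1 m * q"
    using eq by (simp add: ps(1) r_def prod_list_replicate monom_altdef mult.commute)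
  have ord: "order 0 (monom 1 i * p) = i" if "poly p 0 \<noteq> 0" for i and p :: "real poly"
  proof -
    have "p \<noteq> 0" using that by auto
    then show ?thesis using that by (simp add: order_mult order_0I)
  qed
  have "k = m" using ord[OF r] ord[OF q] eq' by metis
  moreover from this have "r = q" using eq' by simp
  ultimately show ?thesis using ps r0 by blast
qed

subsection \<open>The D-optimality objective\<close>

text \<open>For \<open>k < s\<close> the zeros make \<open>tail_avg\<close> a true average of the
  last \<open>s - k\<close> entries of \<open>ps\<close>. An average of nonincreasing numbers
  reaches the first of them only if all agree, so the split falls where the minimum \<open>r\<close>
  of \<open>ps\<close> is first attained, and the power of the average is the product of equal
  entries.\<close>

lemma f_dopt_eq_prod_list:
  assumes X: "dim_row X = n" and es: "sorted_eigenvalues X = ps @ replicate (n - s) 0"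
    and len: "length ps = s" and sorted: "sorted_wrt (\<ge>) ps" and s: "1 \<le> s" "s \<le> n"
  shows "f_dopt s X = prod_list ps"
proof -
  define r where "r = ps ! (s - 1)"
  have anti: "ps ! j \<le> ps ! i" if "i \<le> j" "j < s" for i j
    using sorted that len by (cases "i = j") (auto simp: sorted_wrt_iff_nth_less)
  \<comment> \<open>Eigenvalues are numbered from one, list entries from zero.\<close>
  have eig: "eigval X (Suc i) = ps ! i" if "i < s" for i
    using that len by (simp add: eigval_def es nth_append)
  have eig0: "eigval X i = 0" if "s < i" "i \<le> n" for i
    using that len by (auto simp: eigval_def es nth_append)
  have avg: "tail_avg s X k = (\<Sum>i = k..<s. ps ! i) / (real s - real k)" if "k < s" for k
  proof -
    \<comment> \<open>The eigenvalues beyond \<open>s\<close> vanish, so the sum may stop at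
      \<open>s\<close>.\<close>
    have "(\<Sum>i = k+1..n. eigval X i) = (\<Sum>i = Suc k..<Suc s. eigval X i)"
      using that s by (intro sum.mono_neutral_right) (auto simp: eig0)
    also have "\<dots> = (\<Sum>i = k..<s. ps ! i)"
      unfolding sum.shift_bounds_Suc_ivl by (intro sum.cong) (auto simp: eig)
    finally show ?thesis by (simp add: tail_avg_def X)
  qed
  have avg_const: "tail_avg s X k = r" if k: "k < s" "ps ! k = r" for k
  proof -
    have "ps ! i = r" if "i \<in> {k..<s}" for i
      using anti[of k i] anti[of i "s - 1"] that k by (auto simp: r_def)
    then have "(\<Sum>i = k..<s. ps ! i) = (real s - real k) * r" using k by (simp add: of_nat_diff)
    then show ?thesis using k by (simp add: avg)
  qed
  \<comment> \<open>The differences to the first entry are nonnegative with sum at most 0, so each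
    vanishes, in particular the last.\<close>
  have le_avg: "ps ! k = r" if k: "k < s" "ps ! k \<le> tail_avg s X k" for k
  proof -
    have "(\<Sum>i = k..<s. ps ! k - ps ! i) \<le> 0"
      using k by (simp add: avg sum_subtractf of_nat_diff field_simps)
    moreover have nn: "0 \<le> ps ! k - ps ! i" if "i \<in> {k..<s}" for i using anti[of k i] that by auto
    ultimately have "(\<Sum>i = k..<s. ps ! k - ps ! i) = 0" by (meson antisym sum_nonneg)
    from sum_nonneg_0[OF _ nn this, of "s - 1"] have "ps ! k - ps ! (s - 1) = 0" using k by simp
    then show ?thesis by (simp add: r_def)
  qed
  \<comment> \<open>The right inequality says \<open>ps ! k = r\<close>. The average is then
    \<open>r\<close>, and the left inequality says that \<open>r\<close> does not occur
    earlier.\<close>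
  have split_iff: "(k < s \<and> (k = 0 \<or> eigval X k > tail_avg s X k) \<and> tail_avg s X k \<ge> eigval X (k + 1))
      \<longleftrightarrow> (k < s \<and> ps ! k = r \<and> (\<forall>j<k. ps ! j \<noteq> r))" for k
  proof -
    have left: "(k = 0 \<or> r < eigval X k) \<longleftrightarrow> (\<forall>j<k. ps ! j \<noteq> r)" if k: "k < s"
    proof (cases k)
      case (Suc i)
      have "r < ps ! i \<longleftrightarrow> (\<forall>j<k. ps ! j \<noteq> r)"
      proof
        assume "r < ps ! i"
        then show "\<forall>j<k. ps ! j \<noteq> r"
          using anti[of _ i] k Suc by (metis Suc_lessD less_Suc_eq_le not_le)
      next
        assume "\<forall>j<k. ps ! j \<noteq> r"
        moreover have "r \<le> ps ! i" unfolding r_def by (rule anti) (use k Suc in auto)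
        ultimately show "r < ps ! i" using Suc by (metis lessI order_le_less)
      qed
      then show ?thesis using eig[of i] k Suc by simp
    qed simp
    have right: "tail_avg s X k \<ge> eigval X (k + 1) \<longleftrightarrow> ps ! k = r" if k: "k < s"
      using avg_const[OF k] le_avg[OF k] eig[OF k] by (metis Suc_eq_plus1 order_refl)
    show ?thesis using left right avg_const by metis
  qed
  \<comment> \<open>The zero-based position of the first entry equal to \<open>r\<close> is also the
    number of entries above \<open>r\<close>, which is the split index.\<close>
  define k where "k = (LEAST k. ps ! k = r)"
  have k: "ps ! k = r" "k \<le> s - 1" unfolding k_def
    by (rule LeastI[of _ "s - 1"], simp add: r_def, rule Least_le, simp add: r_def)
  have min: "\<forall>j<k. ps ! j \<noteq> r" using not_less_Least unfolding k_def by blast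
  have ks: "k < s" using k(2) s by simp
  have "split_index s X = k"
    unfolding split_index_def split_iff
    by (rule the_equality) (use k ks min in \<open>auto, metis linorder_neqE_nat\<close>)
  then have "f_dopt s X = (\<Prod>i = 1..k. eigval X i) * r ^ (s - k)"
    unfolding f_dopt_def Let_def using avg_const[OF ks k(1)] by simp
  also have "(\<Prod>i = 1..k. eigval X i) = (\<Prod>i = 0..<k. ps ! i)"
  proof -
    have "{1..k} = {Suc 0..<Suc k}" by auto
    then have "(\<Prod>i = 1..k. eigval X i) = (\<Prod>i = 0..<k. eigval X (Suc i))"
      by (simp only: prod.shift_bounds_Suc_ivl)
    then show ?thesis using ks by (simp add: eig)
  qed
  also have "r ^ (s - k) = (\<Prod>i = k..<s. ps ! i)"
  proof -
    have "(\<Prod>i = k..<s. ps ! i) = (\<Prod>i = k..<s. r)"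
    proof (rule prod.cong)
      fix i assume "i \<in> {k..<s}"
      then show "ps ! i = r" using anti[of k i] anti[of i "s - 1"] k by (auto simp: r_def)
    qed simp
    then show ?thesis by simp
  qed
  also have "(\<Prod>i = 0..<k. ps ! i) * (\<Prod>i = k..<s. ps ! i) = prod_list ps"
    using ks len by (simp add: prod.atLeastLessThan_concat prod.list_conv_set_nth)
  finally show ?thesis .
qed

section \<open>Spectrum of the Gram matrix of selected columns\<close>

text \<open>The identity contributes \<open>v \<bullet> v\<close> and the other summand a
  nonnegative form. The purpose is that the determinant does not vanish.\<close>

lemma pos_def_one_add_diag:
  fixes B :: "real mat"
  assumes B: "B \<in> carrier_mat d n" and e: "\<And>i. i < n \<Longrightarrow> 0 \<le> e i"
  shows "pos_def d (1\<^sub>m d + B * mat_diag n e * transpose_mat B)"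
proof -
  let ?M = "B * mat_diag n e * transpose_mat B"
  have Bt: "transpose_mat B \<in> carrier_mat n d" using B by simp
  have BD: "B * mat_diag n e \<in> carrier_mat d n" by (rule mult_carrier_mat[OF B mat_diag_dim])
  have M: "?M \<in> carrier_mat d d" by (rule mult_carrier_mat[OF BD Bt])
  have "transpose_mat ?M = ?M"
    unfolding transpose_mult[OF BD Bt] transpose_mult[OF B mat_diag_dim] transpose_mat_diag
    using assoc_mult_mat[OF B mat_diag_dim Bt, of e] by simp
  then have "transpose_mat (1\<^sub>m d + ?M) = 1\<^sub>m d + ?M"
    using M by (simp add: transpose_add[of _ d d])
  moreover have "0 < v \<bullet> ((1\<^sub>m d + ?M) *\<^sub>v v)" if v: "v \<in> carrier_vec d" "v \<noteq> 0\<^sub>v d" for v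
  proof -
    have "(1\<^sub>m d + ?M) *\<^sub>v v = v + ?M *\<^sub>v v"
      using add_mult_distrib_mat_vec[OF one_carrier_mat M v(1)] v(1) by simp
    then have "v \<bullet> ((1\<^sub>m d + ?M) *\<^sub>v v) = v \<bullet> v + v \<bullet> (?M *\<^sub>v v)"
      using scalar_prod_add_distrib[OF v(1) v(1) mult_mat_vec_carrier[OF M v(1)]] by simp
    moreover have "0 \<le> v \<bullet> (?M *\<^sub>v v)"
      unfolding quadratic_form_diag[OF B v(1)] by (intro sum_nonneg) (simp add: e)
    ultimately show ?thesis using scalar_prod_self_pos[OF v] by simp
  qed
  ultimately show ?thesis unfolding pos_def_def using M by auto
qed

lemma nonneg_quadratic_form_eigenvalues:
  fixes X :: "real mat"
  assumes X: "X \<in> carrier_mat n n" and psd: "\<And>x. x \<in> carrier_vec n \<Longrightarrow> 0 \<le> x \<bullet> (X *\<^sub>v x)"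
    and root: "poly (char_poly X) l = 0"
  shows "0 \<le> l"
proof -
  obtain x where x: "x \<in> carrier_vec n" "x \<noteq> 0\<^sub>v n" "X *\<^sub>v x = l \<cdot>\<^sub>v x"
    using eigenvalue_root_char_poly[OF X] root X unfolding eigenvalue_def eigenvector_def by auto
  have "0 \<le> l * (x \<bullet> x)" using psd[OF x(1)] x by simp
  then show ?thesis using scalar_prod_self_pos[OF x(1,2)] by (simp add: zero_le_mult_iff)
qed

text \<open>The constant term of the factor \<open>q\<close> of the characteristic polynomial is
  computed twice: the selected rows give \<open>(- 1) ^ s\<close> times the determinant, the
  eigenvalues \<open>(- 1) ^ s\<close> times the product of the positive ones, which is the value of
  \<open>f_dopt\<close>.\<close>

lemma f_dopt_selected_columns:
  fixes B V :: "real mat"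
  assumes B: "B \<in> carrier_mat d n" and V: "V \<in> carrier_mat n n" and detV: "det V \<noteq> 0"
    and VV: "1\<^sub>m n + transpose_mat B * B = transpose_mat V * V"
    and S: "S \<subseteq> {0..<n}" and card: "card S = s" and s: "1 \<le> s"
  defines "E \<equiv> mat_diag n (\<lambda>i. of_bool (i \<in> S))"
  shows "f_dopt s (V * E * transpose_mat V) = det (1\<^sub>m d + B * E * transpose_mat B)"
    and "0 < f_dopt s (V * E * transpose_mat V)"
proof -
  let ?X = "V * E * transpose_mat V" and ?K = "transpose_mat B * B"
    and ?det = "det (1\<^sub>m d + B * E * transpose_mat B)"
  have E: "E \<in> carrier_mat n n" by (simp add: E_def)
  have K: "?K \<in> carrier_mat n n" and X: "?X \<in> carrier_mat n n" using B V E by auto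
  have sn: "s \<le> n" using card_mono[OF _ S] card by simp
  have Xsym: "transpose_mat ?X = ?X"
    using V E transpose_mat_diag[of n "\<lambda>i. of_bool (i \<in> S) :: real", folded E_def]
    by (simp add: transpose_mult[of _ n n _ n] assoc_mult_mat[of _ n n _ n _ n])
  obtain W where W: "W \<in> carrier_mat n n" "V * W = 1\<^sub>m n" "W * V = 1\<^sub>m n"
    using mat_inverse_nonsingular[OF V detV] by blast
  \<comment> \<open>The Cholesky identity enters here: \<open>V\<close> conjugates
    \<open>E * (transpose_mat V * V)\<close> into \<open>V * E * transpose_mat V\<close>.\<close>
  have "V * (E * (1\<^sub>m n + ?K)) * W = V * E * transpose_mat V * (V * W)"
    unfolding VV using V E W(1) by (simp add: assoc_mult_mat[of _ n n _ n _ n])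
  then have "?X = V * (E * (1\<^sub>m n + ?K)) * W" using right_mult_one_mat[OF X] W(2) by simp
  moreover have "E * (1\<^sub>m n + ?K) \<in> carrier_mat n n"
    by (rule mult_carrier_mat[OF E add_carrier_mat[OF K]])
  ultimately have "similar_mat_wit ?X (E * (1\<^sub>m n + ?K)) V W"
    using similar_mat_witI[OF W(2,3) _ X _ V W(1)] by simp
  then have "similar_mat ?X (E * (1\<^sub>m n + ?K))" unfolding similar_mat_def by (intro exI)
  then have cp: "char_poly ?X = char_poly (E * (1\<^sub>m n + ?K))" by (rule char_poly_similar)
  obtain q where q: "char_poly ?X = monom 1 (n - s) * q"
      "poly q 0 = (- 1) ^ s * det (1\<^sub>m n + E * ?K)"
    using char_poly_select_rows[OF K S] unfolding cp card E_def[symmetric] by blast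
  have "det (1\<^sub>m n + E * ?K) = det (1\<^sub>m n + (E * transpose_mat B) * B)"
    using E B by (simp add: assoc_mult_mat[of _ n n _ d _ n])
  \<comment> \<open>The swap with \<open>P = B\<close> and \<open>Q = E * transpose_mat B\<close>
    passes from size \<open>n\<close> to size \<open>d\<close>.\<close>
  also have "\<dots> = det (1\<^sub>m d + B * (E * transpose_mat B))"
    by (rule det_one_add_mult_swap[OF _ B]) (use E B in auto)
  also have "\<dots> = ?det" using E B by (simp add: assoc_mult_mat[of _ d n _ n _ d])
  finally have q0: "poly q 0 = (- 1) ^ s * ?det" using q(2) by simp
  \<comment> \<open>This rules out zero eigenvalues beyond those forced by the monomial
    factor.\<close>
  have "?det \<noteq> 0"
    unfolding E_def by (intro pos_def_det_nonzero[OF pos_def_one_add_diag[OF B]]) simp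
  then have q_nz: "poly q 0 \<noteq> 0" by (simp add: q0)
  obtain es where es: "sorted_wrt (\<ge>) es" "char_poly ?X = (\<Prod>e\<leftarrow>es. [:- e, 1:])"
    using symmetric_char_poly_splits[OF X Xsym] by blast
  have "0 \<le> x \<bullet> (?X *\<^sub>v x)" if "x \<in> carrier_vec n" for x
    unfolding E_def quadratic_form_diag[OF V that] by (intro sum_nonneg) simp
  then have "\<forall>e \<in> set es. 0 \<le> e"
    using nonneg_quadratic_form_eigenvalues[OF X] es(2) by (auto simp: poly_prod_list prod_list_zero_iff)
  then obtain ps where ps: "es = ps @ replicate (n - s) 0" "\<forall>p \<in> set ps. 0 < p"
      "poly q 0 = (- 1) ^ length ps * prod_list ps"
    using prod_list_nonzero_eigenvalues[OF es(1) _ _ q_nz] es(2) q(1) by metis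
  \<comment> \<open>Counting all \<open>n\<close> eigenvalues leaves \<open>s\<close> positive ones;
    \<open>sn\<close> makes the natural subtraction \<open>n - s\<close> exact.\<close>
  have "length es = n"
    using degree_monic_char_poly[OF X] degree_linear_factors[of uminus es] es(2) by simp
  then have len: "length ps = s" using ps(1) sn by simp
  have "f_dopt s ?X = prod_list ps"
  proof (rule f_dopt_eq_prod_list)
    show "sorted_eigenvalues ?X = ps @ replicate (n - s) 0"
      using sorted_eigenvalues_eqI[OF es] ps(1) by simp
    show "sorted_wrt (\<ge>) ps" using es(1) ps(1) by (simp add: sorted_wrt_append)
  qed (use X len s sn in auto)
  moreover have "prod_list ps = ?det" using ps(3) q0 len by simp
  moreover have "0 < prod_list ps" using ps(2) by (induction ps) auto
  ultimately show "f_dopt s ?X = ?det" "0 < f_dopt s ?X" by auto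
qed

section \<open>The fusion determinant and the feasible set\<close>

text \<open>By symmetry of \<open>R\<close> the sum is
  \<open>R * (1 + B * E * transpose_mat B) * R\<close>. For \<open>R\<close> the square root of
  \<open>C\<close> the left side is the fusion determinant.\<close>

lemma det_add_sandwich:
  fixes R B E :: "real mat"
  assumes R: "R \<in> carrier_mat d d" "transpose_mat R = R"
    and B: "B \<in> carrier_mat d n" and E: "E \<in> carrier_mat n n"
  shows "det (R * R + (R * B) * E * transpose_mat (R * B))
    = det (R * R) * det (1\<^sub>m d + B * E * transpose_mat B)"
proof -
  let ?M = "B * E * transpose_mat B"
  have M: "?M \<in> carrier_mat d d" using B E by auto
  have tr: "transpose_mat (R * B) = transpose_mat B * R" using R B by (simp add: transpose_mult[of _ d d _ n])
  have "(R * B) * E * transpose_mat (R * B) = R * ?M * R"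
  proof -
    have Bt: "transpose_mat B \<in> carrier_mat n d" using B by simp
    have BE: "B * E \<in> carrier_mat d n" using B E by simp
    show ?thesis unfolding tr
      by (simp add: assoc_mult_mat[OF R(1) B E] assoc_mult_mat[OF R(1) BE Bt, symmetric]
          assoc_mult_mat[OF mult_carrier_mat[OF R(1) BE] Bt R(1), symmetric])
  qed
  also have "R * R + R * ?M * R = R * (1\<^sub>m d + ?M) * R"
    using R M by (simp add: mult_add_distrib_mat[of _ d d _ d] add_mult_distrib_mat[of _ d d _ _ d])
  finally have "det (R * R + (R * B) * E * transpose_mat (R * B)) = det (R * (1\<^sub>m d + ?M) * R)" by simp
  also have "\<dots> = det R * det (1\<^sub>m d + ?M) * det R"
    using R M by (simp add: det_mult[of _ d])
  also have "\<dots> = det (R * R) * det (1\<^sub>m d + ?M)" using R by (simp add: det_mult[of _ d])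
  finally show ?thesis .
qed

text \<open>A 0/1 vector is the characteristic vector of its support, and its entry sum counts that
  support. Both maxima thereby range over the same subsets.\<close>

lemma Zs_eq_char_vec_image: "Zs n s = char_vec n ` {S. S \<subseteq> {0..<n} \<and> card S = s}"
proof -
  have sum: "(\<Sum>i = 0..<n. char_vec n S $ i) = real (card S)" if "S \<subseteq> {0..<n}" for S
  proof -
    have "(\<Sum>i = 0..<n. char_vec n S $ i) = (\<Sum>i \<in> {0..<n}. if i \<in> S then 1 else 0)"
      by (intro sum.cong) (auto simp: char_vec_def)
    also have "\<dots> = real (card S)" using that by (simp add: sum.If_cases Int_absorb1)
    finally show ?thesis .
  qed
  show ?thesis
  proof (intro subset_antisym subsetI)
    fix x assume x: "x \<in> Zs n s"
    define S where "S = {i. i < n \<and> x $ i = 1}"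
    have S: "S \<subseteq> {0..<n}" by (auto simp: S_def)
    have "x = char_vec n S" using x by (intro eq_vecI) (auto simp: Zs_def char_vec_def S_def)
    moreover have "card S = s" using x sum[OF S] calculation by (simp add: Zs_def)
    ultimately show "x \<in> char_vec n ` {S. S \<subseteq> {0..<n} \<and> card S = s}" using S by blast
  next
    fix x assume "x \<in> char_vec n ` {S. S \<subseteq> {0..<n} \<and> card S = s}"
    then obtain S where "S \<subseteq> {0..<n}" "card S = s" "x = char_vec n S" by blast
    then show "x \<in> Zs n s" using sum by (auto simp: Zs_def) (auto simp: char_vec_def)
  qed
qed

text \<open>Since \<open>ln\<close> is total, the positivity conjunct records that the logarithm of
  \<open>f_dopt\<close> is a genuine one.\<close>

theorem theorem9:
  fixes d n s :: nat and C B V :: "real mat" and a b v :: "nat \<Rightarrow> real vec"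
  assumes "pos_def d C"
    and "\<And>i. i < n \<Longrightarrow> a i \<in> carrier_vec d"
    and "1 \<le> s" and "s \<le> n"
    and "\<And>i. i < n \<Longrightarrow> b i = inv_sqrt_mat C *\<^sub>v a i"
    and "B = mat_of_cols d (map b [0..<n])"
    and "cholesky_factor n (1\<^sub>m n + transpose_mat B * B) V"
    and "\<And>i. i < n \<Longrightarrow> v i = col V i"
  shows "(\<forall>S. S \<subseteq> {0..<n} \<and> card S = s \<longrightarrow>
            char_vec n S \<in> Zs n s \<and>
            0 < f_dopt s (weighted_gram n v (char_vec n S)) \<and>
            fusion_obj d C a S
              = ln (det C) + ln (f_dopt s (weighted_gram n v (char_vec n S)))) \<and>
         Max (fusion_obj d C a ` {S. S \<subseteq> {0..<n} \<and> card S = s})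
           = ln (det C) + Max ((\<lambda>x. ln (f_dopt s (weighted_gram n v x))) ` Zs n s)"
proof -
  define R where "R = sqrt_mat C"
  have pdR: "pos_def d R" and RR: "R * R = C" unfolding R_def by (rule sqrt_mat_pos_def[OF assms(1)])+
  have R: "R \<in> carrier_mat d d" "transpose_mat R = R" using pdR by (auto simp: pos_def_def)
  have detR: "det R \<noteq> 0" by (rule pos_def_det_nonzero[OF pdR])
  have detC: "0 < det C" unfolding RR[symmetric] det_mult[OF R(1) R(1)] using detR
    by (metis not_real_square_gt_zero)
  have Q: "inv_sqrt_mat C \<in> carrier_mat d d" "R * inv_sqrt_mat C = 1\<^sub>m d"
    unfolding inv_sqrt_mat_def R_def[symmetric] using mat_inverse_nonsingular[OF R(1) detR] by auto
  \<comment> \<open>Multiplying by \<open>R\<close> undoes the inverse square root, so the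
    \<open>a i\<close> are the columns of \<open>R * B\<close>.\<close>
  have b: "b i \<in> carrier_vec d" "R *\<^sub>v b i = a i" if "i < n" for i
  proof -
    show "b i \<in> carrier_vec d" using assms(2,5)[OF that] Q by simp
    have "R *\<^sub>v b i = (R * inv_sqrt_mat C) *\<^sub>v a i"
      unfolding assms(5)[OF that] by (rule assoc_mult_mat_vec[symmetric, OF R(1) Q(1) assms(2)[OF that]])
    then show "R *\<^sub>v b i = a i" using Q(2) assms(2)[OF that] by simp
  qed
  have B: "B \<in> carrier_mat d n" by (auto simp: assms(6))
  have colB: "col B i = b i" if "i < n" for i
    using that b by (simp add: assms(6) col_mat_of_cols)
  have a: "a i = col (R * B) i" if "i < n" for i
    using b(2)[OF that] col_mult2[OF R(1) B that] colB[OF that] by simp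
  have V: "V \<in> carrier_mat n n" and VV: "1\<^sub>m n + transpose_mat B * B = transpose_mat V * V"
    and ut: "upper_triangular V" and diag: "\<forall>i<n. 0 < V $$ (i, i)"
    using assms(7) by (auto simp: cholesky_factor_def)
  \<comment> \<open>The determinant of a triangular matrix is the product of its diagonal, here
    positive.\<close>
  have detV: "det V \<noteq> 0"
    using diag V unfolding det_upper_triangular[OF ut V]
    by (force simp: prod_list_zero_iff diag_mat_def)
  have main: "char_vec n S \<in> Zs n s" "0 < f_dopt s (weighted_gram n v (char_vec n S))"
    "fusion_obj d C a S = ln (det C) + ln (f_dopt s (weighted_gram n v (char_vec n S)))"
    if S: "S \<subseteq> {0..<n}" "card S = s" for S
  proof -
    define E :: "real mat" where "E = mat_diag n (\<lambda>i. of_bool (i \<in> S))"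
    have E: "E \<in> carrier_mat n n" by (simp add: E_def)
    have "weighted_gram n v (char_vec n S)
        = finsum_mat n (\<lambda>i. of_bool (i \<in> S) \<cdot>\<^sub>m outer (col V i)) {0..<n}"
      unfolding weighted_gram_def finsum_mat_def using assms(8)
      by (intro cong_mat refl) (auto intro!: sum.cong simp: char_vec_def)
    then have gram: "weighted_gram n v (char_vec n S) = V * E * transpose_mat V"
      unfolding E_def finsum_mat_outer_col[OF V] .
    note f = f_dopt_selected_columns[OF B V detV VV S assms(3), folded E_def, folded gram]
    have "finsum_mat d (\<lambda>i. outer (a i)) S
        = finsum_mat d (\<lambda>i. of_bool (i \<in> S) \<cdot>\<^sub>m outer (a i)) {0..<n}"
      by (rule finsum_mat_subset[OF S(1)]) (use assms(2) in \<open>fastforce simp: outer_def\<close>)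
    also have "\<dots> = finsum_mat d (\<lambda>i. of_bool (i \<in> S) \<cdot>\<^sub>m outer (col (R * B) i)) {0..<n}"
      unfolding finsum_mat_def by (intro cong_mat refl) (auto intro!: sum.cong simp: a)
    also have "\<dots> = (R * B) * E * transpose_mat (R * B)"
      unfolding E_def by (rule finsum_mat_outer_col) (use R B in simp)
    finally have "fusion_obj d C a S = ln (det (R * R + (R * B) * E * transpose_mat (R * B)))"
      by (simp add: fusion_obj_def RR)
    also have "\<dots> = ln (det C * f_dopt s (weighted_gram n v (char_vec n S)))"
      unfolding f(1) using det_add_sandwich[OF R B E] by (simp only: RR)
    also have "\<dots> = ln (det C) + ln (f_dopt s (weighted_gram n v (char_vec n S)))"
      using detC f(2) by (rule ln_mult_pos)
    finally show "fusion_obj d C a S = ln (det C) + ln (f_dopt s (weighted_gram n v (char_vec n S)))" .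
    show "char_vec n S \<in> Zs n s" unfolding Zs_eq_char_vec_image using S by blast
    show "0 < f_dopt s (weighted_gram n v (char_vec n S))" by (rule f(2))
  qed
  let ?\<S> = "{S. S \<subseteq> {0..<n} \<and> card S = s}"
  let ?g = "\<lambda>S. ln (f_dopt s (weighted_gram n v (char_vec n S)))"
  have fin: "finite ?\<S>" by (rule finite_subset[of _ "Pow {0..<n}"]) auto
  \<comment> \<open>With finiteness this makes \<open>Max\<close> meaningful; a set of size
    \<open>s\<close> exists because \<open>s \<le> n\<close>.\<close>
  have ne: "?\<S> \<noteq> {}" using obtain_subset_with_card_n[of s "{0..<n}"] assms(4) by auto
  have "fusion_obj d C a ` ?\<S> = (\<lambda>S. ?g S + ln (det C)) ` ?\<S>"
    using main(3) by (intro image_cong) auto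
  then have "Max (fusion_obj d C a ` ?\<S>) = Max (?g ` ?\<S>) + ln (det C)"
    using Max_add_commute[OF fin ne, of ?g "ln (det C)"] by simp
  moreover have "(\<lambda>x. ln (f_dopt s (weighted_gram n v x))) ` Zs n s = ?g ` ?\<S>"
    unfolding Zs_eq_char_vec_image image_image ..
  ultimately show ?thesis using main by (auto simp: add.commute)
qed

end
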